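(* Let $X$ be a metrizable space with $|X|>2$. Then, for every $d\in\operatorname{Met}_{\mathrm{tb}}(X)$ and every $\varepsilon>0$, there exists $e\in\operatorname{Met}_{\mathrm{tb}}(X)$ with $\mathcal D_X(d,e)<\varepsilon$ such that the compact completion of $(X,e)$ has trivial isometry group. In particular, $\mathrm{R}(X)\cap\operatorname{Met}_{\mathrm{tb}}(X)$ is dense in $\operatorname{Met}_{\mathrm{tb}}(X)$.
   Context: For a metrizable space $X$, $\operatorname{Met}(X)$ denotes the set of all metrics on $X$ inducing the topology of $X$. For $d,e\in\operatorname{Met}(X)$, put $\mathcal D_X(d,e)=\sup_{x,y\in X}|d(x,y)-e(x,y)|\in[0,\infty]$. $\operatorname{Met}(X)$ carries the uniform topology, i.e. the topology induced by the metric $\min\{1,\mathcal D_X\}$. $\operatorname{Met}_{\mathrm{tb}}(X)$ denotes the set of totally bounded metrics in $\operatorname{Met}(X)$, with the subspace topology from $\operatorname{Met}(X)$. The metric completion of a totally bounded metric space is compact; it is called here the compact completion. All isometry groups consist of bijective self-isometries: $\operatorname{Isom}(X,d)$ is the group of bijective self-isometries of $(X,d)$. The set of rigid metrics is $\mathrm{R}(X)=\{d\in\operatorname{Met}(X)\mid \operatorname{Isom}(X,d)=\{\mathrm{id}_X\}\}$. *)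

theory Defs
  imports "HOL-Analysis.Analysis"
begin

section \<open>Spaces of metrics\<close>

text \<open>Metrics on \<open>X\<close> are functions on all of \<^typ>\<open>'a\<close>; normalising them to \<open>0\<close> off \<open>topspace X\<close>
  makes two of them equal precisely when they agree on \<open>topspace X\<close>.\<close>

definition Met :: "'a topology \<Rightarrow> ('a \<Rightarrow> 'a \<Rightarrow> real) set" where
  "Met X = {d. Metric_space (topspace X) d \<and> Metric_space.mtopology (topspace X) d = X \<and>
               (\<forall>x y. x \<notin> topspace X \<or> y \<notin> topspace X \<longrightarrow> d x y = 0)}"

definition sup_dist :: "'a set \<Rightarrow> ('a \<Rightarrow> 'a \<Rightarrow> real) \<Rightarrow> ('a \<Rightarrow> 'a \<Rightarrow> real) \<Rightarrow> ennreal" where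
  "sup_dist S d e = (SUP (x, y) \<in> S \<times> S. ennreal \<bar>d x y - e x y\<bar>)"

definition uniform_dist :: "'a set \<Rightarrow> ('a \<Rightarrow> 'a \<Rightarrow> real) \<Rightarrow> ('a \<Rightarrow> 'a \<Rightarrow> real) \<Rightarrow> real" where
  "uniform_dist S d e = enn2real (min 1 (sup_dist S d e))"

definition Met_topology :: "'a topology \<Rightarrow> ('a \<Rightarrow> 'a \<Rightarrow> real) topology" where
  "Met_topology X = Metric_space.mtopology (Met X) (uniform_dist (topspace X))"

definition Met_tb :: "'a topology \<Rightarrow> ('a \<Rightarrow> 'a \<Rightarrow> real) set" where
  "Met_tb X = {d \<in> Met X. Metric_space.mtotally_bounded (topspace X) d (topspace X)}"

definition Met_tb_topology :: "'a topology \<Rightarrow> ('a \<Rightarrow> 'a \<Rightarrow> real) topology" where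
  "Met_tb_topology X = subtopology (Met_topology X) (Met_tb X)"

lemma sup_dist_le_iff:
  "sup_dist S d e \<le> c \<longleftrightarrow> (\<forall>x\<in>S. \<forall>y\<in>S. ennreal \<bar>d x y - e x y\<bar> \<le> c)"
  by (auto simp: sup_dist_def SUP_le_iff)

lemma sup_dist_commute: "sup_dist S d e = sup_dist S e d"
  by (simp add: sup_dist_def abs_minus_commute)

lemma sup_dist_triangle: "sup_dist S d f \<le> sup_dist S d e + sup_dist S e f"
proof (unfold sup_dist_le_iff, intro ballI)
  fix x y assume xy: "x \<in> S" "y \<in> S"
  have "ennreal \<bar>d x y - f x y\<bar> \<le> ennreal (\<bar>d x y - e x y\<bar> + \<bar>e x y - f x y\<bar>)"
    by (intro ennreal_leI) linarith
  also have "\<dots> = ennreal \<bar>d x y - e x y\<bar> + ennreal \<bar>e x y - f x y\<bar>"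
    by simp
  also have "\<dots> \<le> sup_dist S d e + sup_dist S e f"
    using sup_dist_le_iff[of S d e "sup_dist S d e"] sup_dist_le_iff[of S e f "sup_dist S e f"] xy
    by (intro add_mono) auto
  finally show "ennreal \<bar>d x y - f x y\<bar> \<le> sup_dist S d e + sup_dist S e f" .
qed

lemma sup_dist_eq_0_iff: "sup_dist S d e = 0 \<longleftrightarrow> (\<forall>x\<in>S. \<forall>y\<in>S. d x y = e x y)"
proof -
  have "sup_dist S d e = 0 \<longleftrightarrow> sup_dist S d e \<le> 0"
    by simp
  also have "\<dots> \<longleftrightarrow> (\<forall>x\<in>S. \<forall>y\<in>S. d x y = e x y)"
    unfolding sup_dist_le_iff by (auto simp: ennreal_eq_0_iff)
  finally show ?thesis .
qed

lemma Metric_space_Met: "Metric_space (Met X) (uniform_dist (topspace X))"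
proof
  fix d e f
  let ?D = "sup_dist (topspace X)"
  show "0 \<le> uniform_dist (topspace X) d e"
    by (simp add: uniform_dist_def)
  show "uniform_dist (topspace X) d e = uniform_dist (topspace X) e d"
    by (simp add: uniform_dist_def sup_dist_commute)
  have le: "min 1 (?D d f) \<le> min 1 (?D d e) + min 1 (?D e f)"
  proof (cases "1 \<le> ?D d e \<or> 1 \<le> ?D e f")
    case True
    then have "1 \<le> min 1 (?D d e) + min 1 (?D e f)"
      by (auto simp: min_def intro: add_increasing add_increasing2)
    then show ?thesis
      by (rule min.coboundedI1)
  next
    case False
    then have "min 1 (?D d e) + min 1 (?D e f) = ?D d e + ?D e f"
      by (simp add: min_def)
    then show ?thesis
      using sup_dist_triangle[of "topspace X" d f e] by (simp add: min.coboundedI2)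
  qed
  have fin: "min 1 (?D g h) < top" for g h
    by (simp add: min_less_iff_disj)
  show "uniform_dist (topspace X) d f \<le> uniform_dist (topspace X) d e + uniform_dist (topspace X) e f"
    unfolding uniform_dist_def
    using enn2real_mono[OF le] fin by (simp add: enn2real_plus)
  assume "d \<in> Met X" "e \<in> Met X"
  then have "?D d e = 0 \<longleftrightarrow> d = e"
    unfolding sup_dist_eq_0_iff by (fastforce simp: Met_def fun_eq_iff)
  then show "uniform_dist (topspace X) d e = 0 \<longleftrightarrow> d = e"
    by (auto simp: uniform_dist_def enn2real_eq_0_iff min_def split: if_splits)
qed

lemma topspace_Met_tb_topology: "topspace (Met_tb_topology X) = Met_tb X"
  by (auto simp: Met_tb_topology_def Met_topology_def Met_tb_def
      Metric_space.topspace_mtopology[OF Metric_space_Met])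


section \<open>Isometry groups\<close>

text \<open>Self-maps of \<open>S\<close> are taken to be \<open>undefined\<close> off \<open>S\<close>, so that each is a single HOL function
  and the identity of \<open>S\<close> is \<open>\<lambda>x\<in>S. x\<close>.\<close>

definition Isom :: "'a set \<Rightarrow> ('a \<Rightarrow> 'a \<Rightarrow> real) \<Rightarrow> ('a \<Rightarrow> 'a) set" where
  "Isom S d = {f \<in> extensional S. bij_betw f S S \<and> (\<forall>x\<in>S. \<forall>y\<in>S. d (f x) (f y) = d x y)}"

definition Rigid :: "'a topology \<Rightarrow> ('a \<Rightarrow> 'a \<Rightarrow> real) set" where
  "Rigid X = {d \<in> Met X. Isom (topspace X) d = {\<lambda>x\<in>topspace X. x}}"


section \<open>Metric completion\<close>

text \<open>The completion is realised as the closure of the isometric image of \<open>(S, d)\<close> under the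
  Kuratowski embedding into the complete space of bounded real-valued functions on \<open>S\<close>.
  Subtracting the distance from a base point keeps the functions bounded when \<open>d\<close> is not;
  the choice of base point only matters up to isometry. The lemmas below establish the defining
  properties of the completion (complete, with \<open>(S, d)\<close> isometrically embedded as a dense subset),
  and its compactness when \<open>d\<close> is totally bounded.\<close>

definition kuratowski :: "'a set \<Rightarrow> ('a \<Rightarrow> 'a \<Rightarrow> real) \<Rightarrow> 'a \<Rightarrow> ('a \<Rightarrow> real)" where
  "kuratowski S d x = (\<lambda>u\<in>S. d x u - d (SOME a. a \<in> S) u)"

definition completion_of :: "'a set \<Rightarrow> ('a \<Rightarrow> 'a \<Rightarrow> real) \<Rightarrow> ('a \<Rightarrow> real) metric" where
  "completion_of S d =
     submetric (funspace S euclidean_metric)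
       (mtopology_of (funspace S euclidean_metric) closure_of (kuratowski S d ` S))"

context Metric_space
begin

lemma kuratowski_in_funspace:
  assumes "x \<in> M"
  shows "kuratowski M d x \<in> mspace (funspace M euclidean_metric)"
proof -
  define a where "a = (SOME a. a \<in> M)"
  have a: "a \<in> M"
    using assms unfolding a_def by (rule someI)
  have "\<bar>d x u - d a u\<bar> \<le> d x a" if "u \<in> M" for u
    using triangle[OF assms a that] triangle[OF a assms that] commute[of a x] by linarith
  then have "bounded (kuratowski M d x ` M)"
    by (auto simp: bounded_iff kuratowski_def a_def)
  then show ?thesis
    by (simp add: Met_TC.fspace_def kuratowski_def)
qed

lemma mdist_kuratowski:
  assumes "x \<in> M" "y \<in> M"
  shows "mdist (funspace M euclidean_metric) (kuratowski M d x) (kuratowski M d y) = d x y"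
proof (rule antisym)
  have ne: "M \<noteq> {}"
    using assms by auto
  show "mdist (funspace M euclidean_metric) (kuratowski M d x) (kuratowski M d y) \<le> d x y"
    unfolding Urysohn.funspace_mdist_le[OF assms[THEN kuratowski_in_funspace] ne]
  proof
    fix u assume "u \<in> M"
    then show "mdist euclidean_metric (kuratowski M d x u) (kuratowski M d y u) \<le> d x y"
      using triangle[of x y u] triangle[of y x u] commute[of x y] assms
      by (simp add: kuratowski_def dist_real_def)
  qed
  have "mdist euclidean_metric (kuratowski M d x y) (kuratowski M d y y)
          \<le> mdist (funspace M euclidean_metric) (kuratowski M d x) (kuratowski M d y)"
    using Urysohn.funspace_mdist_le[OF assms[THEN kuratowski_in_funspace] ne] assms(2) by blast
  then show "d x y \<le> mdist (funspace M euclidean_metric) (kuratowski M d x) (kuratowski M d y)"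
    using assms by (simp add: kuratowski_def dist_real_def)
qed

lemma mspace_completion_of:
  "mspace (completion_of M d) =
     mtopology_of (funspace M euclidean_metric) closure_of (kuratowski M d ` M)"
  using closure_of_subset_topspace[of "mtopology_of (funspace M euclidean_metric)"]
  by (auto simp: completion_of_def simp del: mspace_funspace)

lemma kuratowski_in_completion: "x \<in> M \<Longrightarrow> kuratowski M d x \<in> mspace (completion_of M d)"
  unfolding mspace_completion_of
  by (rule subsetD[OF closure_of_subset])
     (auto simp: kuratowski_in_funspace simp del: mspace_funspace)

lemma completion_of_isometric:
  "x \<in> M \<Longrightarrow> y \<in> M \<Longrightarrow> mdist (completion_of M d) (kuratowski M d x) (kuratowski M d y) = d x y"
  using mdist_kuratowski by (simp add: completion_of_def del: mdist_funspace)

lemma completion_of_dense: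
  "mtopology_of (completion_of M d) closure_of (kuratowski M d ` M) = mspace (completion_of M d)"
  using kuratowski_in_completion unfolding mspace_completion_of
  by (simp add: completion_of_def mtopology_of_submetric closure_of_subtopology
      Int_absorb1 image_subset_iff)

lemma mcomplete_completion_of: "mcomplete_of (completion_of M d)"
proof -
  let ?F = "funspace M (euclidean_metric :: real metric)"
  let ?C = "mtopology_of ?F closure_of (kuratowski M d ` M)"
  have "?C \<subseteq> mspace ?F"
    by (metis closure_of_subset_topspace topspace_mtopology_of)
  then interpret S: Submetric "mspace ?F" "mdist ?F" ?C
    by (simp add: Submetric.intro Submetric_axioms_def del: mspace_funspace mdist_funspace)
  have "S.mcomplete"
    using Met_TC.mcomplete_funspace[where ?'b = 'a, of M] complete_UNIV
    by (simp add: mcomplete_of_def euclidean_metric_def Met_TC.Self_def)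
  moreover have "closedin S.mtopology ?C"
    by (metis closedin_closure_of mtopology_of_def)
  ultimately have "S.sub.mcomplete"
    using S.closedin_eq_mcomplete by blast
  moreover have "mspace (completion_of M d) = ?C" "mdist (completion_of M d) = mdist ?F"
    by (simp_all only: mspace_completion_of) (simp only: completion_of_def mdist_submetric)
  ultimately show ?thesis
    by (simp only: mcomplete_of_def)
qed

lemma compact_space_completion_of:
  assumes "mtotally_bounded M"
  shows "compact_space (mtopology_of (completion_of M d))"
proof -
  define m where "m = completion_of M d"
  define k where "k = kuratowski M d"
  have k: "k x \<in> mspace m" if "x \<in> M" for x
    unfolding k_def m_def using that by (rule kuratowski_in_completion)
  have iso: "mdist m (k x) (k y) = d x y" if "x \<in> M" "y \<in> M" for x y
    unfolding k_def m_def using that by (rule completion_of_isometric)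
  interpret C: Metric_space "mspace m" "mdist m"
    by (rule Metric_space_mspace_mdist)
  have "C.mtotally_bounded (k ` M)"
    unfolding C.mtotally_bounded_def
  proof (intro strip)
    fix r :: real assume "r > 0"
    then obtain K where K: "finite K" "K \<subseteq> M" "M \<subseteq> (\<Union>x\<in>K. mball x r)"
      using assms by (auto simp: mtotally_bounded_def)
    have "k y \<in> (\<Union>x\<in>k ` K. C.mball x r)" if "y \<in> M" for y
    proof -
      obtain x where "x \<in> K" "y \<in> mball x r"
        using subsetD[OF K(3) \<open>y \<in> M\<close>] by (rule UN_E)
      then have "k y \<in> C.mball (k x) r"
        using K(2) \<open>y \<in> M\<close> by (auto simp: k iso)
      with \<open>x \<in> K\<close> show ?thesis
        by blast
    qed
    then show "\<exists>K. finite K \<and> K \<subseteq> k ` M \<and> k ` M \<subseteq> (\<Union>x\<in>K. C.mball x r)"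
      using K by (intro exI[of _ "k ` K"]) auto
  qed
  then have "C.mtotally_bounded (C.mtopology closure_of (k ` M))"
    by (rule C.mtotally_bounded_closure_of)
  moreover have "C.mtopology closure_of (k ` M) = mspace m"
    using completion_of_dense unfolding mtopology_of_def m_def k_def .
  moreover have "C.mcomplete"
    using mcomplete_completion_of unfolding mcomplete_of_def m_def .
  ultimately have "compact_space C.mtopology"
    unfolding C.compact_space_eq_mcomplete_mtotally_bounded by simp
  then show ?thesis
    by (simp only: mtopology_of_def m_def)
qed

end

end

theory Submission
  imports Defs
begin

text \<open>
  On the compact completion \<open>(K, d)\<close> we replace \<open>d\<close> by \<open>e = d + (\<Sum>j. \<bar>b\<^sub>j(x) - b\<^sub>j(y)\<bar>)\<close>, where \<open>b\<^sub>j\<close> is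
  a bump of slope \<open>c / 3\<^sup>j\<close> around a point \<open>p\<^sub>j\<close>; as the bumps are Lipschitz with summable constants,
  \<open>d \<le> e \<le> (1 + 3c/2) d\<close>. The pair \<open>p\<^sub>0, p\<^sub>1\<close> realises the diameter of \<open>d\<close>, and \<open>p\<^sub>k\<^sub>+\<^sub>1\<close> is a point farthest
  from \<open>p\<^sub>0, \<dots>, p\<^sub>k\<close> for the partial sum of \<open>e\<close> containing the bumps \<open>b\<^sub>0, \<dots>, b\<^sub>k\<close>. The new bump
  makes \<open>p\<^sub>k\<^sub>+\<^sub>1\<close> the unique farthest point, and the geometric decay of the slopes keeps it unique in the limit.
  So a distance-preserving self-map of \<open>(K, e)\<close> permutes \<open>{p\<^sub>0, p\<^sub>1}\<close>, the unique diametral pair, and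
  fixes all other \<open>p\<^sub>k\<close>. Since \<open>(p\<^sub>k)\<close> is dense, it fixes every point outside \<open>{p\<^sub>0, p\<^sub>1}\<close>, in particular
  some third point \<open>z\<close>; the bumps at \<open>p\<^sub>0\<close> and \<open>p\<^sub>1\<close> have different heights, which makes
  \<open>e(z, p\<^sub>0) \<noteq> e(z, p\<^sub>1)\<close> and excludes swapping \<open>p\<^sub>0\<close> and \<open>p\<^sub>1\<close>.
\<close>

section \<open>Bump perturbations of a metric\<close>

text \<open>With \<open>max 1 j\<close> the radius at \<open>j = 0\<close> is not a minimum over the empty set, and the bumps
  at \<open>p\<^sub>0\<close> and \<open>p\<^sub>1\<close> get the same radius and disjoint supports.\<close>

definition sep_radius :: "('a \<Rightarrow> 'a \<Rightarrow> real) \<Rightarrow> (nat \<Rightarrow> 'a) \<Rightarrow> nat \<Rightarrow> real" where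
  "sep_radius d p j = Min ((\<lambda>(i, l). d (p i) (p l) / 2) ` {(i, l). i < l \<and> l \<le> max 1 j})"

text \<open>With ratio 3 the slopes after the \<open>j\<close>-th add up to
  \<open>c / 3 ^ j / 2\<close>, half of the \<open>j\<close>-th, so later bumps never undo an
  earlier one.\<close>

definition bump :: "('a \<Rightarrow> 'a \<Rightarrow> real) \<Rightarrow> real \<Rightarrow> (nat \<Rightarrow> 'a) \<Rightarrow> nat \<Rightarrow> 'a \<Rightarrow> real" where
  "bump d c p j x = c / 3 ^ j * max 0 (sep_radius d p j - d x (p j))"

definition partial_metric ::
    "('a \<Rightarrow> 'a \<Rightarrow> real) \<Rightarrow> real \<Rightarrow> (nat \<Rightarrow> 'a) \<Rightarrow> nat \<Rightarrow> 'a \<Rightarrow> 'a \<Rightarrow> real" where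
  "partial_metric d c p k x y = d x y + (\<Sum>j\<le>k. \<bar>bump d c p j x - bump d c p j y\<bar>)"

definition bump_metric ::
    "('a \<Rightarrow> 'a \<Rightarrow> real) \<Rightarrow> real \<Rightarrow> (nat \<Rightarrow> 'a) \<Rightarrow> 'a \<Rightarrow> 'a \<Rightarrow> real" where
  "bump_metric d c p x y = d x y + (\<Sum>j. \<bar>bump d c p j x - bump d c p j y\<bar>)"

lemma finite_sep_pairs: "finite {(i, l). i < l \<and> l \<le> (n :: nat)}"
  by (rule finite_subset[of _ "{..n} \<times> {..n}"]) auto

lemma sep_radius_le:
  assumes "i < l" "l \<le> max 1 j"
  shows "2 * sep_radius d p j \<le> d (p i) (p l)"
proof -
  have "sep_radius d p j \<le> d (p i) (p l) / 2"
    unfolding sep_radius_def using assms by (intro Min_le) (auto simp: finite_sep_pairs)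
  then show ?thesis
    by simp
qed

lemma sep_radius_attained:
  obtains i l where "i < l" "l \<le> max 1 j" "2 * sep_radius d p j = d (p i) (p l)"
proof -
  have "(0, 1) \<in> {(i, l). i < l \<and> l \<le> max 1 j}"
    by auto
  then have "sep_radius d p j \<in> (\<lambda>(i, l). d (p i) (p l) / 2) ` {(i, l). i < l \<and> l \<le> max 1 j}"
    unfolding sep_radius_def by (intro Min_in finite_imageI finite_sep_pairs) blast
  then show ?thesis
    using that by auto
qed

lemma sep_radius_antimono:
  assumes "i \<le> j"
  shows "sep_radius d p j \<le> sep_radius d p i"
proof -
  obtain k l where "k < l" "l \<le> max 1 i" "2 * sep_radius d p i = d (p k) (p l)"
    by (rule sep_radius_attained)
  moreover from this have "2 * sep_radius d p j \<le> d (p k) (p l)"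
    using assms by (intro sep_radius_le) auto
  ultimately show ?thesis
    by linarith
qed

lemma sep_radius_cong:
  assumes "\<And>i. i \<le> max 1 j \<Longrightarrow> p i = q i"
  shows "sep_radius d p j = sep_radius d q j"
  unfolding sep_radius_def using assms by (intro arg_cong[of _ _ Min] image_cong) auto

text \<open>This makes the greedy choice a legitimate recursion: stage \<open>k\<close> reads only
  \<open>p 0\<close>, ..., \<open>p k\<close>. The bound \<open>1 \<le> k\<close> is there because
  \<open>max 1 j\<close> lets the radius at \<open>0\<close> read \<open>p 1\<close>.\<close>

lemma partial_metric_cong:
  assumes "\<And>i. i \<le> k \<Longrightarrow> p i = q i" "1 \<le> k"
  shows "partial_metric d c p k x y = partial_metric d c q k x y"
proof -
  have "bump d c p j u = bump d c q j u" if "j \<le> k" for j u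
    using assms that sep_radius_cong[of j p q d] by (simp add: bump_def)
  then show ?thesis
    by (simp add: partial_metric_def)
qed

lemma geometric_tail_sums:
  fixes c :: real
  shows "(\<lambda>j. c / 3 ^ (j + k)) sums (3 / 2 * (c / 3 ^ k))"
  using sums_mult[OF geometric_sums[of "1 / 3 :: real"], of "c / 3 ^ k"]
  by (simp add: power_add power_one_over field_simps)

locale bump_space = Metric_space M d for M :: "'a set" and d +
  fixes c :: real and p :: "nat \<Rightarrow> 'a"
  assumes c_pos: "0 < c" and p_in [simp]: "\<And>i. p i \<in> M"
begin

abbreviation r where "r \<equiv> sep_radius d p"
abbreviation b where "b \<equiv> bump d c p"
abbreviation E where "E \<equiv> partial_metric d c p"
abbreviation e where "e \<equiv> bump_metric d c p"

definition tail :: "nat \<Rightarrow> 'a \<Rightarrow> real" where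
  "tail k x = (\<Sum>j. b (j + Suc k) x)"

lemma r_nonneg: "0 \<le> r j"
proof -
  obtain k l where "2 * r j = d (p k) (p l)"
    by (rule sep_radius_attained)
  with nonneg[of "p k" "p l"] show ?thesis
    by linarith
qed

lemma b_nonneg: "0 \<le> b j x"
  using c_pos by (simp add: bump_def)

lemma b_Lipschitz:
  assumes "x \<in> M" "y \<in> M"
  shows "\<bar>b j x - b j y\<bar> \<le> c / 3 ^ j * d x y"
proof -
  have "\<bar>max 0 (r j - d x (p j)) - max 0 (r j - d y (p j))\<bar> \<le> d x y"
    using triangle[of x y "p j"] triangle[of y x "p j"] commute[of x y] assms nonneg[of x y] p_in[of j]
    by (auto simp: max_def)
  moreover have "\<bar>b j x - b j y\<bar> = c / 3 ^ j * \<bar>max 0 (r j - d x (p j)) - max 0 (r j - d y (p j))\<bar>"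
    unfolding bump_def right_diff_distrib[symmetric] using c_pos by (simp add: abs_mult)
  ultimately show ?thesis
    using c_pos by (simp add: mult_left_mono divide_right_mono)
qed

lemma summable_weights: "summable (\<lambda>j. c / 3 ^ j * s)"
  using summable_mult2[OF sums_summable[OF geometric_tail_sums[of c 0]]] by simp

lemma b_le: "b j x \<le> c / 3 ^ j * r j"
  using c_pos r_nonneg[of j] nonneg[of x "p j"]
  by (auto simp: bump_def intro!: mult_left_mono divide_right_mono)

lemma summable_b: "summable (\<lambda>j. b j x)"
proof (rule summable_comparison_test'[OF summable_weights[of "r 0"], of 0])
  fix j
  have "c / 3 ^ j * r j \<le> c / 3 ^ j * r 0"
    using c_pos sep_radius_antimono[of 0 j d p] by (intro mult_left_mono) auto
  with b_le[of j x] b_nonneg[of j x] show "norm (b j x) \<le> c / 3 ^ j * r 0"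
    by simp
qed

lemma summable_b_diff: "summable (\<lambda>j. \<bar>b j x - b j y\<bar>)"
proof (rule summable_comparison_test'[OF summable_add[OF summable_b summable_b], of 0])
  show "norm \<bar>b j x - b j y\<bar> \<le> b j x + b j y" for j
    using b_nonneg[of j x] b_nonneg[of j y] by simp
qed

lemma e_ge: "x \<in> M \<Longrightarrow> y \<in> M \<Longrightarrow> d x y \<le> e x y"
  unfolding bump_metric_def using suminf_nonneg[OF summable_b_diff] by simp

lemma e_le:
  assumes "x \<in> M" "y \<in> M"
  shows "e x y \<le> (1 + 3 / 2 * c) * d x y"
proof -
  have "(\<Sum>j. \<bar>b j x - b j y\<bar>) \<le> (\<Sum>j. c / 3 ^ j * d x y)"
    by (intro suminf_le b_Lipschitz assms summable_b_diff summable_weights)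
  also have "\<dots> = 3 / 2 * c * d x y"
    using sums_mult2[OF geometric_tail_sums[of c 0], of "d x y"] by (simp add: sums_iff)
  finally show ?thesis
    by (simp add: bump_metric_def algebra_simps)
qed

lemma Metric_space_e: "Metric_space M e"
proof (rule Metric_space.intro)
  show e_nonneg: "0 \<le> e x y" for x y
    using suminf_nonneg[OF summable_b_diff] by (simp add: bump_metric_def)
  show "e x y = e y x" for x y
    by (simp add: bump_metric_def commute abs_minus_commute)
  show "e x y = 0 \<longleftrightarrow> x = y" if "x \<in> M" "y \<in> M" for x y
    using e_ge[OF that] e_le[OF that] zero[OF that] nonneg[of x y] e_nonneg[of x y]
    by (cases "x = y") (simp, linarith)
  show "e x z \<le> e x y + e y z" if "x \<in> M" "y \<in> M" "z \<in> M" for x y z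
  proof -
    have "(\<Sum>j. \<bar>b j x - b j z\<bar>) \<le> (\<Sum>j. \<bar>b j x - b j y\<bar> + \<bar>b j y - b j z\<bar>)"
      by (intro suminf_le summable_add summable_b_diff) auto
    also have "\<dots> = (\<Sum>j. \<bar>b j x - b j y\<bar>) + (\<Sum>j. \<bar>b j y - b j z\<bar>)"
      by (intro suminf_add[symmetric] summable_b_diff)
    finally show ?thesis
      using triangle[OF that] by (simp add: bump_metric_def)
  qed
qed

text \<open>Where \<open>b j\<close> is positive, \<open>x\<close> is within \<open>r j\<close> of
  \<open>p j\<close>, while \<open>p i\<close> is at least \<open>2 * r j\<close> away from
  \<open>p j\<close>; hence \<open>x\<close> is at least \<open>r j\<close> away from
  \<open>p i\<close>.\<close>

lemma b_later:
  assumes "i < j" "x \<in> M"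
  shows "b j x \<le> c / 3 ^ j * min (r i) (d x (p i))"
proof -
  have "max 0 (r j - d x (p j)) \<le> min (r i) (d x (p i))"
  proof (cases "d x (p j) < r j")
    case True
    have "2 * r j \<le> d (p i) (p j)"
      using assms by (intro sep_radius_le) auto
    with True have "r j \<le> d x (p i)"
      using triangle[of "p i" x "p j"] commute[of "p i" x] assms by simp
    then show ?thesis
      using sep_radius_antimono[of i j d p] assms r_nonneg[of j] nonneg[of x "p j"] by linarith
  qed (use r_nonneg in auto)
  then show ?thesis
    using c_pos by (simp add: bump_def mult_left_mono divide_right_mono)
qed

lemma b_later_at: "i < j \<Longrightarrow> b j (p i) = 0"
  using b_later[of i j "p i"] b_nonneg[of j "p i"] r_nonneg[of i] by (simp add: min_absorb2)

lemma summable_b_shift: "summable (\<lambda>j. b (j + k) x)"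
  by (rule summable_ignore_initial_segment[OF summable_b])

lemma tail_Suc: "tail k x = b (Suc k) x + tail (Suc k) x"
  unfolding tail_def using suminf_split_head[OF summable_b_shift[of "Suc k" x]] by simp

text \<open>Sums \<open>b_later\<close> over \<open>j > i\<close>, where the weights
  \<open>c / 3 ^ j\<close> total \<open>c / 3 ^ i / 2\<close>.\<close>

lemma tail_le:
  assumes "x \<in> M"
  shows "tail i x \<le> c / 3 ^ i / 2 * min (r i) (d x (p i))"
proof -
  have "tail i x \<le> (\<Sum>j. c / 3 ^ (j + Suc i) * min (r i) (d x (p i)))"
    unfolding tail_def
    by (intro suminf_le b_later assms summable_b_shift summable_mult2
        sums_summable[OF geometric_tail_sums]) auto
  also have "\<dots> = 3 / 2 * (c / 3 ^ Suc i) * min (r i) (d x (p i))"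
    using sums_mult2[OF geometric_tail_sums[of c "Suc i"]] by (simp add: sums_iff)
  finally show ?thesis
    by simp
qed

lemma tail_at: "i \<le> k \<Longrightarrow> tail k (p i) = 0"
  unfolding tail_def by (simp add: b_later_at)

text \<open>At distance \<open>t\<close> from \<open>p\<^sub>i\<close>, the bump at \<open>p\<^sub>i\<close> loses \<open>c / 3\<^sup>i * min r\<^sub>i t\<close>, while all later bumps together
  recover at most half of that.\<close>

lemma b_tail_le:
  assumes "x \<in> M"
  shows "b i x + tail i x \<le> c / 3 ^ i * r i - c / 3 ^ i / 2 * min (r i) (d x (p i))"
proof -
  have "max 0 (r i - d x (p i)) = r i - min (r i) (d x (p i))"
    using r_nonneg[of i] by auto
  then have "b i x = c / 3 ^ i * r i - c / 3 ^ i * min (r i) (d x (p i))"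
    unfolding bump_def by (simp only: right_diff_distrib)
  with tail_le[OF assms, of i] show ?thesis
    by (simp add: field_simps)
qed

lemma b_at: "b i (p i) = c / 3 ^ i * r i"
  using r_nonneg[of i] by (simp add: bump_def)

lemma e_eq_partial:
  shows "e x y = E k x y + (\<Sum>j. \<bar>b (j + Suc k) x - b (j + Suc k) y\<bar>)"
  using suminf_split_initial_segment[OF summable_b_diff[of x y], of "Suc k"]
  by (simp add: bump_metric_def partial_metric_def lessThan_Suc_atMost)

lemma e_le_partial:
  shows "e x y \<le> E k x y + tail k x + tail k y"
proof -
  have "(\<Sum>j. \<bar>b (j + Suc k) x - b (j + Suc k) y\<bar>) \<le> (\<Sum>j. b (j + Suc k) x + b (j + Suc k) y)"
  proof (rule suminf_le)
    show "summable (\<lambda>j. \<bar>b (j + Suc k) x - b (j + Suc k) y\<bar>)"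
      by (rule summable_ignore_initial_segment[OF summable_b_diff])
    show "\<bar>b (j + Suc k) x - b (j + Suc k) y\<bar> \<le> b (j + Suc k) x + b (j + Suc k) y" for j
      using b_nonneg[of "j + Suc k" x] b_nonneg[of "j + Suc k" y] by simp
  qed (intro summable_add summable_b_shift)
  also have "\<dots> = tail k x + tail k y"
    unfolding tail_def by (intro suminf_add[symmetric] summable_b_shift)
  finally show ?thesis
    using e_eq_partial[of x y k] by simp
qed

text \<open>All bumps after \<open>k\<close> vanish at \<open>p i\<close>, so the estimate
  \<open>e_le_partial\<close> becomes an equality at a centre.\<close>

lemma e_at:
  assumes "i \<le> k"
  shows "e x (p i) = E k x (p i) + tail k x"
  using e_eq_partial[of x "p i" k] assms
  by (simp add: tail_def b_later_at b_nonneg)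

lemma E_ge: "d x y \<le> E k x y"
  by (simp add: partial_metric_def sum_nonneg)

lemma E_le_e: "E k x y \<le> e x y"
proof -
  have "summable (\<lambda>j. \<bar>b (j + Suc k) x - b (j + Suc k) y\<bar>)"
    by (rule summable_ignore_initial_segment[OF summable_b_diff])
  then show ?thesis
    using e_eq_partial[of x y k] suminf_nonneg by fastforce
qed

text \<open>Supplies the continuity by which compactness yields farthest points for
  \<open>E k\<close>.\<close>

lemma E_Lipschitz:
  assumes "x \<in> M" "y \<in> M" "z \<in> M"
  shows "E k x z \<le> E k y z + (1 + 3 / 2 * c) * d x y"
proof -
  have "(\<Sum>j\<le>k. \<bar>b j x - b j z\<bar>) \<le> (\<Sum>j\<le>k. \<bar>b j x - b j y\<bar> + \<bar>b j y - b j z\<bar>)"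
    by (intro sum_mono) linarith
  then have "E k x z \<le> E k x y + E k y z"
    using triangle[OF assms] by (simp add: partial_metric_def sum.distrib)
  also have "E k x y \<le> (1 + 3 / 2 * c) * d x y"
    using E_le_e e_le[OF assms(1,2)] by (rule order_trans)
  finally show ?thesis
    by simp
qed

end

section \<open>Greedy sequences of centres\<close>

text \<open>\<open>greedy\<close> compares distances to the set of earlier centres: the minimum of
  \<open>E k x (p i)\<close> over \<open>i \<le> k\<close> is at most that of
  \<open>E k (p (Suc k)) (p j)\<close> over \<open>j \<le> k\<close>. The quantifier form avoids
  \<open>Min\<close>.\<close>

locale greedy_bump_space = bump_space +
  assumes totally_bounded: "mtotally_bounded M"
    and diametral: "\<And>x y. x \<in> M \<Longrightarrow> y \<in> M \<Longrightarrow> d x y \<le> d (p 0) (p 1)"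
    and p0_neq_p1: "p 0 \<noteq> p 1"
    and greedy: "\<And>k x. 1 \<le> k \<Longrightarrow> x \<in> M \<Longrightarrow>
                   \<exists>i\<le>k. \<forall>j\<le>k. E k x (p i) \<le> E k (p (Suc k)) (p j)"
begin

lemma r_0: "2 * r 0 = d (p 0) (p 1)" and r_1: "r 1 = r 0"
proof -
  have "2 * r j = d (p 0) (p 1)" if "j \<le> 1" for j
  proof -
    obtain i l where il: "i < l" "l \<le> max 1 j" "2 * r j = d (p i) (p l)"
      by (rule sep_radius_attained)
    with that have "l = 1" "i = 0"
      by auto
    with il show ?thesis
      by simp
  qed
  from this[of 0] this[of 1] show "2 * r 0 = d (p 0) (p 1)" "r 1 = r 0"
    by simp_all
qed

lemma r_0_pos: "0 < r 0"
  using r_0 p0_neq_p1 zero[of "p 0" "p 1"] nonneg[of "p 0" "p 1"] by (simp del: nonneg zero)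

text \<open>If the radius degenerates, two centres coincide, so the greedy sequence had already exhausted \<open>M\<close>
  (which is finite).\<close>

lemma r_eq_0_imp_repeated:
  assumes "1 \<le> k" "r (Suc k) = 0"
  shows "p (Suc k) \<in> p ` {..k}"
proof -
  obtain i l where il: "i < l" "l \<le> max 1 (Suc k)" "2 * r (Suc k) = d (p i) (p l)"
    by (rule sep_radius_attained)
  then have eq: "p i = p l"
    using assms zero[of "p i" "p l"] by simp
  define l' where "l' = l - 1"
  have l': "l = Suc l'" "l' \<le> k" "i \<le> l'"
    using il assms unfolding l'_def by auto
  \<comment> \<open>As \<open>p 0 \<noteq> p 1\<close>, the centre \<open>p l\<close> was chosen
    greedily at a stage \<open>l' \<ge> 1\<close>. Being farthest from a set that contains it, it
    forces every point to be one of \<open>p 0\<close>, ..., \<open>p l'\<close>.\<close>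
  have "l' \<noteq> 0"
    using eq p0_neq_p1 l' by (cases l') auto
  then obtain i' where i': "i' \<le> l'" "\<forall>j\<le>l'. E l' (p (Suc k)) (p i') \<le> E l' (p l) (p j)"
    using greedy[of l' "p (Suc k)"] l' by auto
  then have "E l' (p (Suc k)) (p i') \<le> E l' (p l) (p l)"
    using l' eq by metis
  also have "E l' (p l) (p l) = 0"
    by (simp add: partial_metric_def)
  finally have "d (p (Suc k)) (p i') \<le> 0"
    using E_ge[of "p (Suc k)" "p i'" l'] by linarith
  then have "p (Suc k) = p i'"
    using nonneg[of "p (Suc k)" "p i'"] zero[of "p (Suc k)" "p i'"] by simp
  then show ?thesis
    using i' l' by auto
qed

text \<open>If \<open>x\<close> stayed \<open>\<eta>\<close> away from all centres, every greedy
  choice, being at least as far from its predecessors, would be \<open>\<eta>\<close> away from them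
  for \<open>E k\<close>, hence \<open>s\<close> away for \<open>d\<close>. Total boundedness
  excludes such a sequence.\<close>

lemma dense:
  assumes x: "x \<in> M" and "0 < \<eta>"
  shows "\<exists>j. d x (p j) < \<eta>"
proof (rule ccontr)
  assume far: "\<nexists>j. d x (p j) < \<eta>"
  define s where "s = \<eta> / (1 + 3 / 2 * c)"
  have L: "0 < 1 + 3 / 2 * c"
    using c_pos by simp
  with assms have "0 < s"
    by (simp add: s_def)
  have separated: "s \<le> d (p l) (p i)" if "i < l" "2 \<le> l" for i l
  proof -
    define k where "k = l - 1"
    have k: "l = Suc k" "1 \<le> k" "i \<le> k"
      using that unfolding k_def by auto
    obtain i' where i': "i' \<le> k" "\<forall>j\<le>k. E k x (p i') \<le> E k (p (Suc k)) (p j)"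
      using greedy[OF k(2) x] by blast
    have "\<eta> \<le> d x (p i')"
      using far by (simp add: not_less)
    also have "\<dots> \<le> E k x (p i')"
      by (rule E_ge)
    also have "\<dots> \<le> E k (p l) (p i)"
      using i' k by simp
    also have "\<dots> \<le> e (p l) (p i)"
      by (rule E_le_e)
    also have "\<dots> \<le> (1 + 3 / 2 * c) * d (p l) (p i)"
      by (intro e_le) simp_all
    finally show ?thesis
      using L by (simp add: s_def pos_divide_le_eq mult.commute)
  qed
  obtain \<rho> :: "nat \<Rightarrow> nat" where \<rho>: "strict_mono \<rho>" "MCauchy (p \<circ> \<rho>)"
    using totally_bounded unfolding mtotally_bounded_sequentially by (metis image_subsetI p_in)
  then obtain N where N: "\<And>n n'. N \<le> n \<Longrightarrow> N \<le> n' \<Longrightarrow> d (p (\<rho> n)) (p (\<rho> n')) < s"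
    using \<open>0 < s\<close> unfolding MCauchy_def o_apply by meson
  \<comment> \<open>The shift by 2 makes the larger index at least 2, as \<open>separated\<close>
    demands; \<open>p 0\<close> and \<open>p 1\<close> were not chosen greedily.\<close>
  have "\<rho> (N + 2) < \<rho> (N + 3)" "N + 2 \<le> \<rho> (N + 2)"
    using \<rho>(1) by (simp_all add: strict_mono_less strict_mono_imp_increasing)
  then show False
    using separated[of "\<rho> (N + 2)" "\<rho> (N + 3)"] N[of "N + 3" "N + 2"] by simp
qed

text \<open>The radii \<open>r 0\<close> and \<open>r 1\<close> add up to
  \<open>d (p 0) (p 1)\<close>, so the supports are disjoint balls.\<close>

lemma b_0_or_b_1:
  assumes "x \<in> M"
  shows "b 0 x = 0 \<or> b 1 x = 0"
proof -
  have "r 0 \<le> d x (p 0) \<or> r 1 \<le> d x (p 1)"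
    using r_0 r_1 triangle[of "p 0" x "p 1"] commute[of x "p 0"] assms by auto
  then show ?thesis
    by (auto simp: bump_def)
qed

lemma b_0_eq_0: "x \<in> M \<Longrightarrow> r 0 \<le> d x (p 0) \<Longrightarrow> b 0 x = 0"
  by (simp add: bump_def)

lemma b_0_p1: "b 0 (p 1) = 0"
  using r_0 r_0_pos commute[of "p 0" "p 1"] by (intro b_0_eq_0) auto

lemma e_p0:
  assumes "x \<in> M"
  shows "e x (p 0) = d x (p 0) + (c * r 0 - b 0 x) + b 1 x + tail 1 x"
  using e_at[of 0 1 x] b_le[of 0 x] b_at[of 0] b_later_at[of 0 1] b_nonneg[of 1 x]
  by (simp add: partial_metric_def)

lemma e_p1:
  assumes "x \<in> M"
  shows "e x (p 1) = d x (p 1) + b 0 x + (c / 3 * r 1 - b 1 x) + tail 1 x"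
  using e_at[of 1 1 x] b_le[of 1 x] b_at[of 1] b_0_p1 b_nonneg[of 0 x]
  by (simp add: partial_metric_def)

text \<open>The pair \<open>p 0\<close>, \<open>p 1\<close> maximises \<open>d\<close> and gains
  both full peaks \<open>?h0 + ?h1\<close>. Any other pair gains at most one value of each bump plus
  tails, and \<open>b_tail_le\<close> shows that this reaches the two peaks only at the centres
  themselves.\<close>

lemma diametral_pair_unique:
  assumes x: "x \<in> M" and y: "y \<in> M" and "e (p 0) (p 1) \<le> e x y"
  shows "{x, y} = {p 0, p 1}"
proof -
  let ?h0 = "c * r 0" and ?h1 = "c / 3 * r 1"
  have peaks: "e (p 0) (p 1) = d (p 0) (p 1) + ?h0 + ?h1"
    using e_p1[of "p 0"] b_at[of 0] b_later_at[of 0 1] tail_at[of 0 1] by simp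
  have A: "b 0 u + tail 1 u \<le> ?h0 - c / 2 * min (r 0) (d u (p 0))" if "u \<in> M" for u
    using b_tail_le[OF that, of 0] tail_Suc[of 0 u] b_nonneg[of 1 u] by simp
  have B: "b 1 u + tail 1 u \<le> ?h1 - c / 6 * min (r 1) (d u (p 1))" if "u \<in> M" for u
    using b_tail_le[OF that, of 1] by simp
  have at: "u = p 0 \<and> v = p 1" if "u \<in> M" "v \<in> M" "?h0 + ?h1 \<le> b 0 u + b 1 v + tail 1 u + tail 1 v" for u v
  proof -
    have nn: "0 \<le> min (r 0) (d u (p 0))" "0 \<le> min (r 1) (d v (p 1))"
      using r_nonneg by simp_all
    have "c / 2 * min (r 0) (d u (p 0)) + c / 6 * min (r 1) (d v (p 1)) \<le> 0"
      using A[of u] B[of v] that by linarith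
    moreover have "0 \<le> c / 2 * min (r 0) (d u (p 0))" "0 \<le> c / 6 * min (r 1) (d v (p 1))"
      using nn c_pos by simp_all
    ultimately have "c / 2 * min (r 0) (d u (p 0)) = 0" "c / 6 * min (r 1) (d v (p 1)) = 0"
      by linarith+
    then have "d u (p 0) = 0" "d v (p 1) = 0"
      using c_pos r_0_pos r_1 nn by (auto simp: min_def split: if_splits)
    then show ?thesis
      using that by simp
  qed
  have "d (p 0) (p 1) + ?h0 + ?h1
          \<le> d x y + \<bar>b 0 x - b 0 y\<bar> + \<bar>b 1 x - b 1 y\<bar> + tail 1 x + tail 1 y"
    using assms(3) e_le_partial[of x y 1] peaks by (simp add: partial_metric_def)
  then have "?h0 + ?h1 \<le> \<bar>b 0 x - b 0 y\<bar> + \<bar>b 1 x - b 1 y\<bar> + tail 1 x + tail 1 y"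
    using diametral[OF x y] by simp
  \<comment> \<open>At each of \<open>x\<close> and \<open>y\<close> one of the two bumps vanishes,
    so only a cross combination of the heights can survive.\<close>
  moreover have "\<bar>b 0 x - b 0 y\<bar> + \<bar>b 1 x - b 1 y\<bar> \<le> max (b 0 x + b 1 y) (b 0 y + b 1 x)"
    using b_0_or_b_1[OF x] b_0_or_b_1[OF y] b_nonneg[of 0 x] b_nonneg[of 1 x]
      b_nonneg[of 0 y] b_nonneg[of 1 y]
    by (auto simp: abs_if max_def)
  ultimately have "?h0 + ?h1 \<le> b 0 x + b 1 y + tail 1 x + tail 1 y \<or>
                   ?h0 + ?h1 \<le> b 0 y + b 1 x + tail 1 y + tail 1 x"
    by linarith
  then show ?thesis
    using at[OF x y] at[OF y x] by auto
qed

section \<open>Distance-preserving self-maps of the perturbed space\<close>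

context
  fixes f
  assumes f_in: "\<And>x. x \<in> M \<Longrightarrow> f x \<in> M"
    and f_iso: "\<And>x y. x \<in> M \<Longrightarrow> y \<in> M \<Longrightarrow> e (f x) (f y) = e x y"
begin

text \<open>The image \<open>?q\<close> has the same \<open>e\<close>-distances to the earlier
  centres as \<open>p (Suc k)\<close>, up to the permutation by \<open>f\<close>. As
  \<open>p (Suc k)\<close> is farthest for \<open>E k\<close>, the missing amount must come from
  \<open>b (Suc k) ?q + tail (Suc k) ?q\<close>, which attains the full peak only at
  \<open>p (Suc k)\<close>.\<close>

lemma fixes_next:
  assumes "1 \<le> k" and inv: "f ` p ` {..k} = p ` {..k}" and r: "0 < r (Suc k)"
  shows "f (p (Suc k)) = p (Suc k)"
proof -
  let ?q = "f (p (Suc k))" and ?h = "c / 3 ^ Suc k"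
  obtain i where i: "i \<le> k" "\<forall>j\<le>k. E k ?q (p i) \<le> E k (p (Suc k)) (p j)"
    using greedy[OF \<open>1 \<le> k\<close>, of ?q] f_in by auto
  then have "p i \<in> f ` p ` {..k}"
    unfolding inv by auto
  then obtain j where j: "j \<le> k" "p i = f (p j)"
    by auto
  have "e (p (Suc k)) (p j) = e ?q (p i)"
    unfolding j by (simp add: f_iso)
  also have "\<dots> = E k ?q (p i) + (b (Suc k) ?q + tail (Suc k) ?q)"
    using e_at[of i k ?q] i tail_Suc[of k ?q] by simp
  also have "\<dots> \<le> E k (p (Suc k)) (p j)
                   + (?h * r (Suc k) - ?h / 2 * min (r (Suc k)) (d ?q (p (Suc k))))"
    using i(2) j(1) by (intro add_mono b_tail_le) (auto simp: f_in)
  finally have "E k (p (Suc k)) (p j) + ?h * r (Suc k) \<le> E k (p (Suc k)) (p j)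
                   + (?h * r (Suc k) - ?h / 2 * min (r (Suc k)) (d ?q (p (Suc k))))"
    using e_at[OF j(1), of "p (Suc k)"] tail_Suc[of k "p (Suc k)"] b_at[of "Suc k"] tail_at[of "Suc k" "Suc k"]
    by simp
  then have "?h / 2 * min (r (Suc k)) (d ?q (p (Suc k))) \<le> 0"
    by linarith
  moreover have "0 < ?h / 2"
    using c_pos by simp
  ultimately have "min (r (Suc k)) (d ?q (p (Suc k))) \<le> 0"
    by (metis mult_pos_pos not_less)
  then have "d ?q (p (Suc k)) = 0"
    using r nonneg[of ?q "p (Suc k)"] by (smt (verit))
  then show ?thesis
    by (simp add: f_in)
qed

text \<open>Only the set is claimed to be preserved, since a swap of \<open>p 0\<close> and
  \<open>p 1\<close> is not excluded yet.\<close>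

lemma preserves_prefix: "1 \<le> k \<Longrightarrow> f ` p ` {..k} = p ` {..k}"
proof (induction k rule: dec_induct)
  case base
  have "e (f (p 0)) (f (p 1)) = e (p 0) (p 1)"
    by (simp add: f_iso)
  then have "{f (p 0), f (p 1)} = {p 0, p 1}"
    by (intro diametral_pair_unique) (auto simp: f_in)
  moreover have "{..1 :: nat} = {0, 1}"
    by auto
  ultimately show ?case
    by auto
next
  case (step k)
  show ?case
  proof (cases "r (Suc k) = 0")
    case True
    then show ?thesis
      using r_eq_0_imp_repeated[of k] step by (simp add: atMost_Suc insert_absorb)
  next
    case False
    then have "f (p (Suc k)) = p (Suc k)"
      using fixes_next[of k] step r_nonneg[of "Suc k"] by simp
    then show ?thesis
      using step by (simp add: atMost_Suc)
  qed
qed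

text \<open>A centre with positive radius falls under \<open>fixes_next\<close>; one with radius
  \<open>0\<close> repeats an earlier centre, to which the induction applies.\<close>

lemma fixes_centre: "p k \<notin> {p 0, p 1} \<Longrightarrow> f (p k) = p k"
proof (induction k rule: less_induct)
  case (less k)
  then have "k \<noteq> 0" "k \<noteq> 1"
    by (metis insertCI)+
  define k' where "k' = k - 1"
  have k': "k = Suc k'" "1 \<le> k'"
    using \<open>k \<noteq> 0\<close> \<open>k \<noteq> 1\<close> unfolding k'_def by auto
  show ?case
  proof (cases "r k = 0")
    case True
    then obtain j where "j \<le> k'" "p k = p j"
      using r_eq_0_imp_repeated[of k'] k' by auto
    then show ?thesis
      using less k' by simp
  next
    case False
    then show ?thesis
      using fixes_next[of k'] preserves_prefix[of k'] k' r_nonneg[of k] by simp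
  qed
qed

lemma fixes_off_diameter:
  assumes x: "x \<in> M" and "x \<notin> {p 0, p 1}"
  shows "f x = x"
proof -
  interpret e: Metric_space M e
    by (rule Metric_space_e)
  define \<mu> where "\<mu> = min (d x (p 0)) (d x (p 1))"
  have "0 < \<mu>"
    using assms by (simp add: \<mu>_def)
  have L: "0 < 1 + 3 / 2 * c"
    using c_pos by simp
  have "e x (f x) \<le> 0 + \<eta>" if "0 < \<eta>" for \<eta>
  proof -
    \<comment> \<open>Closeness below \<open>\<mu>\<close> keeps \<open>p j\<close> off
      \<open>p 0\<close> and \<open>p 1\<close>, so that \<open>f\<close> fixes it; the other bound
      turns \<open>e x (f x) \<le> 2 * e x (p j)\<close> into at most \<open>\<eta>\<close>.\<close>
    define s where "s = min \<mu> (\<eta> / 2 / (1 + 3 / 2 * c))"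
    have "0 < s"
      using \<open>0 < \<mu>\<close> \<open>0 < \<eta>\<close> L by (simp add: s_def)
    then obtain j where j: "d x (p j) < s"
      using dense[OF x] by blast
    then have "p j \<notin> {p 0, p 1}"
      by (auto simp: s_def \<mu>_def)
    then have "e (f x) (p j) = e x (p j)"
      using f_iso[OF x, of "p j"] fixes_centre by simp
    then have "e x (f x) \<le> 2 * e x (p j)"
      using e.triangle[of x "p j" "f x"] x f_in[OF x] e.commute[of "f x" "p j"] by simp
    also have "e x (p j) \<le> (1 + 3 / 2 * c) * d x (p j)"
      using x by (intro e_le) simp_all
    also have "\<dots> \<le> (1 + 3 / 2 * c) * (\<eta> / 2 / (1 + 3 / 2 * c))"
      using j L by (intro mult_left_mono) (simp_all add: s_def)
    also have "\<dots> = \<eta> / 2"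
      using L by (metis less_irrefl nonzero_mult_div_cancel_left times_divide_eq_right)
    finally show ?thesis
      by simp
  qed
  then have "e x (f x) \<le> 0"
    by (rule field_le_epsilon)
  then show ?thesis
    using e.nonneg[of x "f x"] e.zero[of x "f x"] x f_in[OF x] by simp
qed

text \<open>The fixed point \<open>z\<close> tells \<open>p 0\<close> from \<open>p 1\<close>. It
  lies outside the bump at \<open>p 0\<close>, because
  \<open>2 * r 0 \<le> d z (p 0) + d z (p 1) \<le> 2 * d z (p 0)\<close>, so
  \<open>e z (p 0)\<close> collects the whole higher peak \<open>c * r 0\<close> and exceeds
  \<open>e z (p 1)\<close>.\<close>

lemma isometry_is_identity:
  assumes z: "z \<in> M" "z \<notin> {p 0, p 1}" "d z (p 1) \<le> d z (p 0)" and x: "x \<in> M"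
  shows "f x = x"
proof -
  have pair: "{f (p 0), f (p 1)} = {p 0, p 1}"
    by (intro diametral_pair_unique) (auto simp: f_in f_iso)
  have "r 0 \<le> d z (p 0)"
    using triangle[of "p 0" z "p 1"] commute[of z "p 0"] r_0 z by simp
  then have "b 0 z = 0"
    using z by (intro b_0_eq_0)
  moreover have "c / 3 * r 1 < c * r 0"
    using c_pos r_0_pos r_1 by simp
  moreover have "b 1 z \<ge> 0"
    by (rule b_nonneg)
  ultimately have "e z (p 1) < e z (p 0)"
    using e_p0[of z] e_p1[of z] z by linarith
  moreover have "e z (f (p 0)) = e z (p 0)"
    using f_iso[of z "p 0"] fixes_off_diameter[OF z(1,2)] z by simp
  ultimately have "f (p 0) \<noteq> p 1"
    by auto
  with pair have "f (p 0) = p 0" "f (p 1) = p 1"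
    by (auto simp: doubleton_eq_iff)
  then show ?thesis
    using fixes_off_diameter[OF x] by auto
qed

end

end

section \<open>Existence of the centres in a compact space\<close>

context Metric_space
begin

lemma compact_Lipschitz_attains_max:
  assumes "compact_space mtopology" "M \<noteq> {}"
    and Lip: "\<And>x y. x \<in> M \<Longrightarrow> y \<in> M \<Longrightarrow> g x \<le> g y + L * d x y"
  obtains v where "v \<in> M" "\<And>x. x \<in> M \<Longrightarrow> g x \<le> (g v :: real)"
proof -
  have "\<bar>g x - g y\<bar> \<le> L * d x y" if "x \<in> M" "y \<in> M" for x y
    using Lip[OF that] Lip[OF that(2,1)] commute[of x y] by simp
  then have "Lipschitz_continuous_map (metric (M, d)) euclidean_metric g"
    by (auto simp: Lipschitz_continuous_map_def dist_real_def)
  then have "continuous_map mtopology euclideanreal g"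
    using Lipschitz_continuous_imp_continuous_map mtopology_of by fastforce
  then have "compact (g ` M)"
    using assms(1) image_compactin[of mtopology M euclideanreal g] by (simp add: compact_space_def)
  then show thesis
    using compact_attains_sup[of "g ` M"] assms(2) that by auto
qed

text \<open>Maximises twice: the farthest distance \<open>d x (F x)\<close> from \<open>x\<close> is
  itself 1-Lipschitz in \<open>x\<close>.\<close>

lemma compact_diametral_pair:
  assumes "compact_space mtopology" "M \<noteq> {}"
  obtains a b where "a \<in> M" "b \<in> M" "\<And>x y. x \<in> M \<Longrightarrow> y \<in> M \<Longrightarrow> d x y \<le> d a b"
proof -
  have "\<exists>y\<in>M. \<forall>z\<in>M. d x z \<le> d x y" if "x \<in> M" for x
    using compact_Lipschitz_attains_max[OF assms, of "d x" 1] triangle'[of x] commute that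
    by (metis add.commute mult_1 triangle)
  then obtain F where F: "\<And>x. x \<in> M \<Longrightarrow> F x \<in> M" "\<And>x z. x \<in> M \<Longrightarrow> z \<in> M \<Longrightarrow> d x z \<le> d x (F x)"
    by metis
  have "d x (F x) \<le> d y (F y) + 1 * d x y" if "x \<in> M" "y \<in> M" for x y
    using triangle[of x y "F x"] F(1)[of x] F(2)[of y "F x"] that by simp
  then obtain a where "a \<in> M" "\<And>x. x \<in> M \<Longrightarrow> d x (F x) \<le> d a (F a)"
    using compact_Lipschitz_attains_max[OF assms, of "\<lambda>x. d x (F x)" 1] by blast
  with F that[of a "F a"] show thesis
    by (meson order_trans)
qed

lemma greedy_sequence_exists:
  assumes cpt: "compact_space mtopology" and "0 < c" "a \<in> M" "b \<in> M"
  obtains p where "p 0 = a" "p (Suc 0) = b" "\<And>i. p i \<in> M"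
    "\<And>k x. 1 \<le> k \<Longrightarrow> x \<in> M \<Longrightarrow> \<exists>i\<le>k. \<forall>j\<le>k.
       partial_metric d c p k x (p i) \<le> partial_metric d c p k (p (Suc k)) (p j)"
proof -
  \<comment> \<open>\<open>P p n v\<close> says that \<open>v\<close> is an admissible
    \<open>n\<close>-th centre after \<open>p 0\<close>, ..., \<open>p (n - 1)\<close>; it reads
    nothing else of \<open>p\<close>, as dependent choice requires.\<close>
  define P where "P p n v \<longleftrightarrow> v \<in> M \<and> (n = 0 \<longrightarrow> v = a) \<and> (n = 1 \<longrightarrow> v = b) \<and>
      (2 \<le> n \<longrightarrow> (\<forall>x\<in>M. \<exists>i<n. \<forall>j<n.
         partial_metric d c p (n - 1) x (p i) \<le> partial_metric d c p (n - 1) v (p j)))"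
    for p and n :: nat and v
  have "\<exists>p. \<forall>n. P p n (p n)"
  proof (rule dependent_wellorder_choice)
    fix v and f g :: "nat \<Rightarrow> 'a" and n :: nat
    assume eq: "\<And>m. m < n \<Longrightarrow> f m = g m"
    show "P f n v = P g n v"
    proof (cases "2 \<le> n")
      case True
      then have E_eq: "partial_metric d c f (n - 1) x y = partial_metric d c g (n - 1) x y" for x y
        by (intro partial_metric_cong eq) auto
      have "(\<exists>i<n. \<forall>j<n. partial_metric d c f (n - 1) x (f i) \<le> partial_metric d c f (n - 1) v (f j)) \<longleftrightarrow>
            (\<exists>i<n. \<forall>j<n. partial_metric d c g (n - 1) x (g i) \<le> partial_metric d c g (n - 1) v (g j))" for x
        unfolding E_eq by (metis eq)
      then show ?thesis
        by (simp only: P_def)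
    qed (auto simp: P_def)
  next
    fix n :: nat and f :: "nat \<Rightarrow> 'a"
    assume prev: "\<And>m. m < n \<Longrightarrow> P f m (f m)"
    show "\<exists>v. P f n v"
    proof (cases "2 \<le> n")
      case False
      then show ?thesis
        using assms by (cases "n = 0") (auto simp: P_def)
    next
      case True
      \<comment> \<open>The filler value \<open>a\<close> puts the whole sequence into
        \<open>M\<close>, as \<open>bump_space\<close> demands; the partial metric of index
        \<open>n - 1\<close> never sees it.\<close>
      define q where "q i = (if i < n then f i else a)" for i
      have "f i \<in> M" if "i < n" for i
        using prev[OF that] by (simp add: P_def)
      then interpret bump_space M d c q
        by unfold_locales (simp_all add: q_def \<open>0 < c\<close> \<open>a \<in> M\<close>)
      let ?E = "partial_metric d c q (n - 1)"
      \<comment> \<open>Distance to the centres chosen so far. As a minimum of Lipschitz functions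
        it is Lipschitz, and a maximiser is the next centre.\<close>
      let ?m = "\<lambda>x. Min ((\<lambda>i. ?E x (q i)) ` {..<n})"
      have ne: "{..<n} \<noteq> {}"
        using True by (auto simp: lessThan_empty_iff)
      have attained: "\<exists>i<n. ?m x = ?E x (q i)" for x
      proof -
        have "?m x \<in> (\<lambda>i. ?E x (q i)) ` {..<n}"
          using ne by (intro Min_in) auto
        then show ?thesis
          by (rule imageE) blast
      qed
      have le: "?m x \<le> ?E x (q i)" if "i < n" for x i
        using that by (intro Min_le) auto
      have "?m x \<le> ?m y + (1 + 3 / 2 * c) * d x y" if xy: "x \<in> M" "y \<in> M" for x y
      proof -
        obtain i where "i < n" "?m y = ?E y (q i)"
          using attained by blast
        then show ?thesis
          using le[of i x] E_Lipschitz[OF xy p_in, of "n - 1" i] by linarith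
      qed
      from compact_Lipschitz_attains_max[OF cpt _ this] \<open>a \<in> M\<close>
      obtain v where v: "v \<in> M" "\<And>x. x \<in> M \<Longrightarrow> ?m x \<le> ?m v"
        by (metis empty_iff)
      have eqE: "partial_metric d c f (n - 1) x y = ?E x y" for x y
        using True by (intro partial_metric_cong) (auto simp: q_def)
      have "\<exists>i<n. \<forall>j<n. partial_metric d c f (n - 1) x (f i) \<le> partial_metric d c f (n - 1) v (f j)"
        if x: "x \<in> M" for x
      proof -
        obtain i where "i < n" "?m x = ?E x (q i)"
          using attained by blast
        then have "?E x (q i) \<le> ?E v (q j)" if "j < n" for j
          using v(2)[OF x] le[OF that, of v] by linarith
        with \<open>i < n\<close> show ?thesis
          unfolding eqE by (intro exI[of _ i]) (auto simp: q_def)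
      qed
      then show ?thesis
        using v(1) True by (intro exI[of _ v]) (simp add: P_def)
    qed
  qed
  then obtain p where p: "\<And>n. P p n (p n)"
    by blast
  show thesis
  proof
    show "p 0 = a" "p (Suc 0) = b"
      using p[of 0] p[of "Suc 0"] by (simp_all add: P_def)
    show "p i \<in> M" for i
      using p[of i] by (simp add: P_def)
    show "\<exists>i\<le>k. \<forall>j\<le>k. partial_metric d c p k x (p i) \<le> partial_metric d c p k (p (Suc k)) (p j)"
      if "1 \<le> k" "x \<in> M" for k x
      using p[of "Suc k"] that by (simp add: P_def less_Suc_eq_le)
  qed
qed

lemma compact_rigid_perturbation:
  assumes cpt: "compact_space mtopology" and "0 < \<epsilon>"
    and three: "u \<in> M" "v \<in> M" "w \<in> M" "u \<noteq> v" "u \<noteq> w" "v \<noteq> w"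
  obtains e where "Metric_space M e"
    "\<And>x y. x \<in> M \<Longrightarrow> y \<in> M \<Longrightarrow> d x y \<le> e x y"
    "\<And>x y. x \<in> M \<Longrightarrow> y \<in> M \<Longrightarrow> e x y \<le> (1 + \<epsilon>) * d x y"
    "\<And>f x. f ` M \<subseteq> M \<Longrightarrow> (\<And>x y. x \<in> M \<Longrightarrow> y \<in> M \<Longrightarrow> e (f x) (f y) = e x y) \<Longrightarrow>
       x \<in> M \<Longrightarrow> f x = x"
proof -
  obtain a0 b0 where ab0: "a0 \<in> M" "b0 \<in> M" "\<And>x y. x \<in> M \<Longrightarrow> y \<in> M \<Longrightarrow> d x y \<le> d a0 b0"
    using compact_diametral_pair[OF cpt] three(1) by blast
  obtain z where z: "z \<in> M" "z \<notin> {a0, b0}"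
    using three by (cases "u \<in> {a0, b0}"; cases "v \<in> {a0, b0}") auto
  \<comment> \<open>Orders the diametral pair so that \<open>z\<close> is no closer to the centre
    \<open>a\<close> of the higher bump, as \<open>isometry_is_identity\<close> requires.\<close>
  obtain a b where ab: "a \<in> M" "b \<in> M" "\<And>x y. x \<in> M \<Longrightarrow> y \<in> M \<Longrightarrow> d x y \<le> d a b"
    "z \<notin> {a, b}" "d z b \<le> d z a"
  proof (cases "d z b0 \<le> d z a0")
    case True
    then show ?thesis
      using ab0 z that[of a0 b0] by blast
  next
    case False
    then show ?thesis
      using ab0 z that[of b0 a0] commute[of a0 b0] by auto
  qed
  \<comment> \<open>Chosen so that \<open>1 + 3 / 2 * c = 1 + \<epsilon>\<close>.\<close>
  define c where "c = 2 / 3 * \<epsilon>"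
  have "0 < c"
    using \<open>0 < \<epsilon>\<close> by (simp add: c_def)
  then obtain p where p: "p 0 = a" "p (Suc 0) = b" "\<And>i. p i \<in> M"
    "\<And>k x. 1 \<le> k \<Longrightarrow> x \<in> M \<Longrightarrow> \<exists>i\<le>k. \<forall>j\<le>k.
       partial_metric d c p k x (p i) \<le> partial_metric d c p k (p (Suc k)) (p j)"
    using greedy_sequence_exists[OF cpt _ ab(1,2)] by blast
  have "a \<noteq> b"
  proof
    assume "a = b"
    then have "d u v \<le> 0"
      using ab(3)[OF three(1,2)] ab(1) zero[of a a] by simp
    then show False
      using three zero[of u v] nonneg[of u v] by (simp del: zero nonneg)
  qed
  interpret greedy_bump_space M d c p
  proof unfold_locales
    show "mtotally_bounded M"
      using cpt compactin_imp_mtotally_bounded[of M] by (simp add: compact_space_def)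
    show "x \<in> M \<Longrightarrow> y \<in> M \<Longrightarrow> d x y \<le> d (p 0) (p 1)" for x y
      using ab(3) p(1,2) by simp
    show "p 0 \<noteq> p 1"
      using \<open>a \<noteq> b\<close> p(1,2) by simp
  qed (use \<open>0 < c\<close> p(3,4) in blast)+
  show thesis
  proof
    show "Metric_space M (bump_metric d c p)"
      by (rule Metric_space_e)
    show "d x y \<le> bump_metric d c p x y" "bump_metric d c p x y \<le> (1 + \<epsilon>) * d x y"
      if "x \<in> M" "y \<in> M" for x y
      using e_ge[OF that] e_le[OF that] by (simp_all add: c_def)
    show "f x = x" if "f ` M \<subseteq> M" "x \<in> M"
      "\<And>x y. x \<in> M \<Longrightarrow> y \<in> M \<Longrightarrow> bump_metric d c p (f x) (f y) = bump_metric d c p x y" for f x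
    proof (rule isometry_is_identity)
      show "z \<in> M" "z \<notin> {p 0, p 1}" "d z (p 1) \<le> d z (p 0)"
        using z ab(4,5) p(1,2) by simp_all
    qed (use that in blast)+
  qed
qed

end
section \<open>Transfer to the completion\<close>

locale bilipschitz_metrics = d: Metric_space M d + e: Metric_space M e
  for M :: "'a set" and d e +
  fixes L :: real
  assumes lower: "\<And>x y. x \<in> M \<Longrightarrow> y \<in> M \<Longrightarrow> d x y \<le> e x y"
    and upper: "\<And>x y. x \<in> M \<Longrightarrow> y \<in> M \<Longrightarrow> e x y \<le> L * d x y"
    and L_pos: "0 < L"
begin

lemma mball_subset: "e.mball x \<rho> \<subseteq> d.mball x \<rho>"
  using lower by (force simp: d.in_mball e.in_mball)

lemma mball_superset: "d.mball x (\<rho> / L) \<subseteq> e.mball x \<rho>"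
proof
  fix y assume y: "y \<in> d.mball x (\<rho> / L)"
  then have "L * d x y < \<rho>"
    using L_pos by (simp add: d.in_mball pos_less_divide_eq mult.commute)
  then show "y \<in> e.mball x \<rho>"
    using upper[of x y] y by (auto simp: d.in_mball e.in_mball)
qed

lemma mtopology_eq: "e.mtopology = d.mtopology"
  unfolding topology_eq d.openin_mtopology e.openin_mtopology
  using mball_subset mball_superset L_pos by (metis divide_pos_pos subset_trans)

lemma mtotally_bounded_transfer:
  assumes "d.mtotally_bounded M"
  shows "e.mtotally_bounded M"
  unfolding e.mtotally_bounded_def
proof (intro strip)
  fix \<epsilon> :: real assume "0 < \<epsilon>"
  then have "0 < \<epsilon> / L"
    using L_pos by simp
  with assms obtain K where K: "finite K" "K \<subseteq> M" "M \<subseteq> (\<Union>x\<in>K. d.mball x (\<epsilon> / L))"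
    unfolding d.mtotally_bounded_def by metis
  have "(\<Union>x\<in>K. d.mball x (\<epsilon> / L)) \<subseteq> (\<Union>x\<in>K. e.mball x \<epsilon>)"
    using mball_superset by (rule UN_mono[OF subset_refl])
  with K show "\<exists>K. finite K \<and> K \<subseteq> M \<and> M \<subseteq> (\<Union>x\<in>K. e.mball x \<epsilon>)"
    by (meson subset_trans)
qed

end

section \<open>Extending distance-preserving maps and transporting rigidity\<close>

definition distance_preserving :: "'a metric \<Rightarrow> 'b metric \<Rightarrow> ('a \<Rightarrow> 'b) \<Rightarrow> bool" where
  "distance_preserving m n f \<longleftrightarrow> f \<in> mspace m \<rightarrow> mspace n \<and>
     (\<forall>x\<in>mspace m. \<forall>y\<in>mspace m. mdist n (f x) (f y) = mdist m x y)"

text \<open>Stronger than a trivial \<open>Isom\<close>, as the maps range over all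
  distance-preserving ones; in this form it passes along mere distance-preserving maps.\<close>

definition self_rigid :: "'a metric \<Rightarrow> bool" where
  "self_rigid m \<longleftrightarrow> (\<forall>f. distance_preserving m m f \<longrightarrow> (\<forall>x\<in>mspace m. f x = x))"

lemma distance_preserving_compose:
  "distance_preserving m n f \<Longrightarrow> distance_preserving n l g \<Longrightarrow> distance_preserving m l (g \<circ> f)"
  by (simp add: distance_preserving_def Pi_iff)

lemma distance_preserving_inj:
  assumes "distance_preserving m n f" "x \<in> mspace m" "y \<in> mspace m" "f x = f y"
  shows "x = y"
  using assms by (metis distance_preserving_def mdist_zero)

lemma distance_preserving_extends:
  fixes m :: "'a metric" and n :: "'b metric"
  assumes complete: "mcomplete_of n"
    and S: "S \<subseteq> mspace m" and dense: "mtopology_of m closure_of S = mspace m"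
    and h: "\<And>x. x \<in> S \<Longrightarrow> h x \<in> mspace n"
    and iso: "\<And>x y. x \<in> S \<Longrightarrow> y \<in> S \<Longrightarrow> mdist n (h x) (h y) = mdist m x y"
  obtains g where "distance_preserving m n g" "\<And>x. x \<in> S \<Longrightarrow> g x = h x"
proof -
  interpret m: Metric_space "mspace m" "mdist m"
    by (rule Metric_space_mspace_mdist)
  interpret n: Metric_space "mspace n" "mdist n"
    by (rule Metric_space_mspace_mdist)
  have "Lipschitz_continuous_map (submetric m S) n h"
    unfolding Lipschitz_continuous_map_def using S h iso by (auto intro!: exI[of _ 1])
  then obtain g where g: "Lipschitz_continuous_map m n g" "\<And>x. x \<in> S \<Longrightarrow> g x = h x"
    using Lipschitz_continuous_map_extends_to_closure_of[OF complete, of m S h]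
    unfolding dense submetric_mspace by metis
  then have gM: "\<And>x. x \<in> mspace m \<Longrightarrow> g x \<in> mspace n"
    by (auto simp: Lipschitz_continuous_map_def)
  obtain B where B: "0 < B"
    "\<And>x y. x \<in> mspace m \<Longrightarrow> y \<in> mspace m \<Longrightarrow> mdist n (g x) (g y) \<le> B * mdist m x y"
    using g(1) unfolding Lipschitz_continuous_map_pos by metis
  have approx: "\<exists>s\<in>S. mdist m x s < \<eta>" if "x \<in> mspace m" "0 < \<eta>" for x \<eta>
    using dense that unfolding mtopology_of_def m.metric_closure_of by auto
  have "mdist n (g x) (g y) = mdist m x y" if x: "x \<in> mspace m" and y: "y \<in> mspace m" for x y
  proof -
    have "\<bar>mdist n (g x) (g y) - mdist m x y\<bar> \<le> 0 + \<eta>" if "0 < \<eta>" for \<eta>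
    proof -
      \<comment> \<open>Replacing \<open>x\<close>, \<open>y\<close> by \<open>s\<close>,
        \<open>t\<close> costs at most \<open>2 * \<theta>\<close> in \<open>m\<close> and
        \<open>2 * (B * \<theta>)\<close> in \<open>n\<close>, together
        \<open>\<eta>\<close>.\<close>
      define \<theta> where "\<theta> = \<eta> / (2 * B + 2)"
      have "0 < \<theta>" "(2 * B + 2) * \<theta> = \<eta>"
        using \<open>0 < \<eta>\<close> \<open>0 < B\<close> by (simp_all add: \<theta>_def)
      then have \<theta>: "2 * (B * \<theta>) + 2 * \<theta> = \<eta>"
        by (simp add: algebra_simps)
      from \<open>0 < \<theta>\<close> obtain s t where s: "s \<in> S" "mdist m x s < \<theta>" and t: "t \<in> S" "mdist m y t < \<theta>"
        using approx[OF x] approx[OF y] by blast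
      have M: "s \<in> mspace m" "t \<in> mspace m"
        using s t S by auto
      have "mdist n (g x) (g s) \<le> B * \<theta>" "mdist n (g y) (g t) \<le> B * \<theta>"
        using B(2)[OF x M(1)] B(2)[OF y M(2)] s t \<open>0 < B\<close>
        by (smt (verit) mult_left_mono)+
      moreover have "mdist n (g s) (g t) = mdist m s t"
        using iso s t g(2) by simp
      ultimately show ?thesis
        using n.triangle[of "g x" "g s" "g y"] n.triangle[of "g s" "g t" "g y"]
          n.triangle[of "g s" "g x" "g t"] n.triangle[of "g x" "g y" "g t"]
          m.triangle[of x s y] m.triangle[of s t y] m.triangle[of s x t] m.triangle[of x y t]
          m.commute[of s x] m.commute[of t y] n.commute[of "g s" "g x"] n.commute[of "g t" "g y"]
          gM[OF x] gM[OF y] gM[OF M(1)] gM[OF M(2)] x y M s t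
          \<theta>
        by linarith
    qed
    then have "\<bar>mdist n (g x) (g y) - mdist m x y\<bar> \<le> 0"
      by (rule field_le_epsilon)
    then show ?thesis
      by simp
  qed
  with gM have "distance_preserving m n g"
    by (auto simp: distance_preserving_def)
  from this g(2) show thesis
    by (rule that)
qed

text \<open>By rigidity \<open>g \<circ> h\<close> is the identity, and injectivity of
  \<open>g\<close> makes \<open>h\<close> its two-sided inverse; then \<open>f\<close> is conjugated
  into a self-map of \<open>m\<close>.\<close>

lemma self_rigid_transfer:
  assumes rigid: "self_rigid m" and g: "distance_preserving n m g"
    and h: "distance_preserving m n h"
  shows "self_rigid n"
  unfolding self_rigid_def
proof (intro allI impI ballI)
  have gh: "g (h x) = x" if "x \<in> mspace m" for x
    using rigid distance_preserving_compose[OF h g] that by (auto simp: self_rigid_def)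
  have hg: "h (g y) = y" if "y \<in> mspace n" for y
  proof (rule distance_preserving_inj[OF g])
    show "y \<in> mspace n" "h (g y) \<in> mspace n" "g (h (g y)) = g y"
      using g h that by (auto simp: distance_preserving_def intro!: gh)
  qed
  fix f y assume f: "distance_preserving n n f" and y: "y \<in> mspace n"
  have gy: "g y \<in> mspace m" and fy: "f y \<in> mspace n"
    using g f y by (auto simp: distance_preserving_def)
  have "distance_preserving m m (g \<circ> (f \<circ> h))"
    by (rule distance_preserving_compose[OF distance_preserving_compose[OF h f] g])
  then have "g (f (h (g y))) = g y"
    using rigid gy by (auto simp: self_rigid_def)
  then show "f y = y"
    using hg[OF y] distance_preserving_inj[OF g fy y] by simp
qed

lemma self_rigid_imp_Isom_trivial:
  assumes "self_rigid m"
  shows "Isom (mspace m) (mdist m) = {\<lambda>p\<in>mspace m. p}"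
proof
  show "Isom (mspace m) (mdist m) \<subseteq> {\<lambda>p\<in>mspace m. p}"
  proof
    fix f assume f: "f \<in> Isom (mspace m) (mdist m)"
    then have "distance_preserving m m f"
      by (auto simp: Isom_def distance_preserving_def bij_betw_def)
    with assms f show "f \<in> {\<lambda>p\<in>mspace m. p}"
      by (auto simp: self_rigid_def Isom_def intro!: extensionalityI)
  qed
  have "bij_betw (\<lambda>p\<in>mspace m. p) (mspace m) (mspace m)"
    by (subst bij_betw_restrict_eq) (simp add: bij_betw_def)
  then show "{\<lambda>p\<in>mspace m. p} \<subseteq> Isom (mspace m) (mdist m)"
    by (auto simp: Isom_def)
qed

context Metric_space
begin

lemma embedding_extends:
  assumes complete: "mcomplete_of n" and S: "j ` M \<subseteq> mspace m"
    and dense: "mtopology_of m closure_of (j ` M) = mspace m"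
    and j: "\<And>x y. x \<in> M \<Longrightarrow> y \<in> M \<Longrightarrow> mdist m (j x) (j y) = d x y"
    and h: "\<And>x. x \<in> M \<Longrightarrow> h x \<in> mspace n"
    and iso: "\<And>x y. x \<in> M \<Longrightarrow> y \<in> M \<Longrightarrow> mdist n (h x) (h y) = d x y"
  obtains g where "distance_preserving m n g" "\<And>x. x \<in> M \<Longrightarrow> g (j x) = h x"
proof -
  have "inj_on j M"
  proof (rule inj_onI)
    fix x y assume xy: "x \<in> M" "y \<in> M" "j x = j y"
    then have "j y \<in> mspace m"
      using S by auto
    then have "mdist m (j x) (j y) = 0"
      using xy(3) by simp
    then have "d x y = 0"
      using j[OF xy(1,2)] by simp
    with xy show "x = y"
      by simp
  qed
  then obtain g where "distance_preserving m n g"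
    "\<And>y. y \<in> j ` M \<Longrightarrow> g y = (h \<circ> inv_into M j) y"
    using distance_preserving_extends[OF complete S dense, of "h \<circ> inv_into M j"] h iso j
    by (smt (verit) comp_apply image_iff inv_into_f_f)
  with that \<open>inj_on j M\<close> show thesis
    by simp
qed

text \<open>Uniqueness of completions: \<open>n\<close> and the Kuratowski completion both contain
  \<open>M\<close> densely and are complete, so they map into each other preserving
  distances.\<close>

lemma self_rigid_completion:
  assumes "self_rigid n" "mcomplete_of n" "j ` M \<subseteq> mspace n"
    "mtopology_of n closure_of (j ` M) = mspace n"
    "\<And>x y. x \<in> M \<Longrightarrow> y \<in> M \<Longrightarrow> mdist n (j x) (j y) = d x y"
  shows "self_rigid (completion_of M d)"
proof -
  let ?C = "completion_of M d" and ?k = "kuratowski M d"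
  have k: "?k ` M \<subseteq> mspace ?C"
    using kuratowski_in_completion by auto
  obtain g where "distance_preserving ?C n g"
    by (rule embedding_extends[of n ?k ?C j])
       (use assms k completion_of_dense completion_of_isometric in auto)
  moreover obtain h where "distance_preserving n ?C h"
    by (rule embedding_extends[of ?C j n ?k])
       (use assms k mcomplete_completion_of completion_of_isometric in auto)
  ultimately show ?thesis
    using self_rigid_transfer[OF assms(1)] by blast
qed

text \<open>An isometry of \<open>M\<close> extends to the completion, where it must be the
  identity; the embedding is injective.\<close>

lemma self_rigid_completion_imp_Isom_trivial:
  assumes "self_rigid (completion_of M d)"
  shows "Isom M d = {\<lambda>x\<in>M. x}"
proof
  let ?C = "completion_of M d" and ?k = "kuratowski M d"
  show "Isom M d \<subseteq> {\<lambda>x\<in>M. x}"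
  proof
    fix f assume f: "f \<in> Isom M d"
    then have fM: "f x \<in> M" if "x \<in> M" for x
      using that by (auto simp: Isom_def bij_betw_def)
    obtain g where g: "distance_preserving ?C ?C g" "\<And>x. x \<in> M \<Longrightarrow> g (?k x) = ?k (f x)"
    proof (rule embedding_extends[of ?C ?k ?C "?k \<circ> f"])
      show "?k ` M \<subseteq> mspace ?C"
        using kuratowski_in_completion by auto
      show "mdist ?C ((?k \<circ> f) x) ((?k \<circ> f) y) = d x y" if "x \<in> M" "y \<in> M" for x y
        using completion_of_isometric[OF fM fM] f that by (simp add: Isom_def)
    qed (use mcomplete_completion_of completion_of_dense completion_of_isometric
          kuratowski_in_completion fM in auto)
    have "f x = x" if "x \<in> M" for x
    proof -
      have "?k (f x) = ?k x"
        using assms g(1) g(2)[OF that] kuratowski_in_completion[OF that]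
        unfolding self_rigid_def by metis
      then have "d (f x) x = 0"
        using completion_of_isometric[OF fM[OF that] that] completion_of_isometric[OF that that] that
        by simp
      then show ?thesis
        using fM that by simp
    qed
    with f show "f \<in> {\<lambda>x\<in>M. x}"
      by (auto simp: Isom_def intro!: extensionalityI)
  qed
  have "bij_betw (\<lambda>x\<in>M. x) M M"
    by (subst bij_betw_restrict_eq) (simp add: bij_betw_def)
  then show "{\<lambda>x\<in>M. x} \<subseteq> Isom M d"
    by (auto simp: Isom_def)
qed

end

section \<open>Perturbing on the compact completion and restricting\<close>

lemma Met_tb_rigid_perturbation:
  fixes X :: "'a topology"
  assumes three: "u \<in> topspace X" "v \<in> topspace X" "w \<in> topspace X" "u \<noteq> v" "u \<noteq> w" "v \<noteq> w"
    and d: "d \<in> Met_tb X" and "0 < \<epsilon>"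
  obtains e where "e \<in> Met_tb X" "sup_dist (topspace X) d e < ennreal \<epsilon>"
    "self_rigid (completion_of (topspace X) e)"
proof -
  define M where "M = topspace X"
  have top: "Metric_space M d" "Metric_space.mtopology M d = X"
    "Metric_space.mtotally_bounded M d M"
    using d by (auto simp: Met_tb_def Met_def M_def)
  interpret d: Metric_space M d
    by (rule top)
  define m where "m = completion_of M d"
  define k where "k = kuratowski M d"
  interpret m: Metric_space "mspace m" "mdist m"
    by (rule Metric_space_mspace_mdist)
  have k_in: "k x \<in> mspace m" if "x \<in> M" for x
    using d.kuratowski_in_completion[OF that] by (simp add: m_def k_def)
  have k_iso: "mdist m (k x) (k y) = d x y" if "x \<in> M" "y \<in> M" for x y
    using d.completion_of_isometric[OF that] by (simp add: m_def k_def)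
  have k_dense: "m.mtopology closure_of (k ` M) = mspace m"
    using d.completion_of_dense by (simp add: m_def k_def mtopology_of_def)
  have k_inj: "k x = k y \<longleftrightarrow> x = y" if "x \<in> M" "y \<in> M" for x y
    using k_iso[OF that] k_in[OF that(1)] k_in[OF that(2)] that by (metis d.zero m.zero)
  have compact: "compact_space m.mtopology"
    using d.compact_space_completion_of[OF top(3)] by (simp add: m_def mtopology_of_def)
  obtain B where B: "0 < B" "\<And>x y. x \<in> M \<Longrightarrow> y \<in> M \<Longrightarrow> d x y \<le> B"
    using d.mtotally_bounded_imp_mbounded[OF top(3)] unfolding d.mbounded_alt_pos by blast
  \<comment> \<open>The metric changes by at most \<open>c * d \<le> c * B = \<epsilon> / 2\<close>,
    which leaves room for the strict inequality.\<close>
  define c where "c = \<epsilon> / (2 * B)"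
  have c: "0 < c" "c * B < \<epsilon>"
    using B(1) \<open>0 < \<epsilon>\<close> by (simp_all add: c_def)
  have three': "k u \<in> mspace m" "k v \<in> mspace m" "k w \<in> mspace m" "k u \<noteq> k v" "k u \<noteq> k w" "k v \<noteq> k w"
    using three k_in k_inj by (auto simp: M_def)
  obtain E where E: "Metric_space (mspace m) E"
    "\<And>x y. x \<in> mspace m \<Longrightarrow> y \<in> mspace m \<Longrightarrow> mdist m x y \<le> E x y"
    "\<And>x y. x \<in> mspace m \<Longrightarrow> y \<in> mspace m \<Longrightarrow> E x y \<le> (1 + c) * mdist m x y"
    "\<And>f x. f ` mspace m \<subseteq> mspace m \<Longrightarrow>
       (\<And>x y. x \<in> mspace m \<Longrightarrow> y \<in> mspace m \<Longrightarrow> E (f x) (f y) = E x y) \<Longrightarrow>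
       x \<in> mspace m \<Longrightarrow> f x = x"
    using m.compact_rigid_perturbation[OF compact c(1) three'] by blast
  interpret E: bilipschitz_metrics "mspace m" "mdist m" E "1 + c"
    using E c by (auto intro!: bilipschitz_metrics.intro simp: bilipschitz_metrics_axioms_def)
  \<comment> \<open>The old completion with the metric \<open>E\<close>. The topology is unchanged,
    so \<open>n\<close> is still compact, hence complete, with the image of \<open>k\<close> dense:
    it serves as a completion of the restricted metric \<open>e\<close>.\<close>
  define n where "n = metric (mspace m, E)"
  have n: "mspace n = mspace m" "mdist n = E" "mtopology_of n = m.mtopology"
    using E.e.mspace_metric E.e.mdist_metric E.e.mtopology_of E.mtopology_eq
    by (simp_all add: n_def)
  \<comment> \<open>The value \<open>0\<close> off \<open>M\<close> is the normalisation built into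
    \<open>Met\<close>.\<close>
  define e where "e x y = (if x \<in> M \<and> y \<in> M then E (k x) (k y) else 0)" for x y
  have e_eq: "e x y = E (k x) (k y)" if "x \<in> M" "y \<in> M" for x y
    using that by (simp add: e_def)
  have "Metric_space M e"
  proof
    show "0 \<le> e x y" "e x y = e y x" for x y
      by (auto simp: e_def E.e.commute)
    show "e x y = 0 \<longleftrightarrow> x = y" if "x \<in> M" "y \<in> M" for x y
      using that k_in k_inj by (simp add: e_eq)
    show "e x z \<le> e x y + e y z" if "x \<in> M" "y \<in> M" "z \<in> M" for x y z
      using that k_in by (simp add: e_eq E.e.triangle)
  qed
  then interpret e: bilipschitz_metrics M d e "1 + c"
  proof (intro bilipschitz_metrics.intro bilipschitz_metrics_axioms.intro d.Metric_space_axioms)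
    show "d x y \<le> e x y" "e x y \<le> (1 + c) * d x y" if "x \<in> M" "y \<in> M" for x y
      using E.lower[of "k x" "k y"] E.upper[of "k x" "k y"] that k_in k_iso by (simp_all add: e_eq)
  qed (use c in auto)
  show thesis
  proof
    show "e \<in> Met_tb X"
      using e.mtotally_bounded_transfer[OF top(3)] e.e.Metric_space_axioms e.mtopology_eq top(2)
      by (auto simp: Met_tb_def Met_def e_def simp flip: M_def)
    have "sup_dist (topspace X) d e \<le> ennreal (c * B)"
      unfolding sup_dist_le_iff
    proof (intro ballI ennreal_leI)
      fix x y assume "x \<in> topspace X" "y \<in> topspace X"
      then have xy: "x \<in> M" "y \<in> M"
        by (simp_all add: M_def)
      have "\<bar>d x y - e x y\<bar> \<le> c * d x y"
        using e.lower[OF xy] e.upper[OF xy] by (simp add: algebra_simps)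
      also have "\<dots> \<le> c * B"
        using B(2)[OF xy] c by simp
      finally show "\<bar>d x y - e x y\<bar> \<le> c * B" .
    qed
    also have "\<dots> < ennreal \<epsilon>"
      using c B \<open>0 < \<epsilon>\<close> by (simp add: ennreal_less_iff)
    finally show "sup_dist (topspace X) d e < ennreal \<epsilon>" .
    have "self_rigid (completion_of M e)"
    proof (rule e.e.self_rigid_completion)
      show "self_rigid n"
        unfolding self_rigid_def distance_preserving_def n
      proof (intro allI impI ballI)
        fix f x
        assume f: "f \<in> mspace m \<rightarrow> mspace m \<and>
            (\<forall>x\<in>mspace m. \<forall>y\<in>mspace m. E (f x) (f y) = E x y)"
          and x: "x \<in> mspace m"
        then have "f ` mspace m \<subseteq> mspace m"
          by auto
        then show "f x = x"
          by (rule E(4)) (use f x in auto)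
      qed
      have "compact_space E.e.mtopology"
        using compact E.mtopology_eq by simp
      then have "E.e.mcomplete"
        by (rule E.e.compact_space_imp_mcomplete)
      then show "mcomplete_of n"
        by (simp add: mcomplete_of_def n)
      show "k ` M \<subseteq> mspace n" "mtopology_of n closure_of (k ` M) = mspace n"
        using k_in k_dense by (auto simp: n)
    qed (simp add: n e_eq)
    then show "self_rigid (completion_of (topspace X) e)"
      by (simp add: M_def)
  qed
qed

text \<open>The disjunction expresses \<open>|X| > 2\<close>, as \<open>card\<close> is
  \<open>0\<close> on infinite sets. Both claims follow from rigidity of the completion: directly,
  and by restriction to \<open>X\<close>.\<close>

theorem proposition5p4:
  fixes X :: "'a topology"
  assumes "metrizable_space X"
    and "infinite (topspace X) \<or> card (topspace X) > 2"
  shows "(\<forall>d \<in> Met_tb X. \<forall>\<epsilon>::real. \<epsilon> > 0 \<longrightarrow>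
            (\<exists>e \<in> Met_tb X. sup_dist (topspace X) d e < ennreal \<epsilon> \<and>
               Isom (mspace (completion_of (topspace X) e)) (mdist (completion_of (topspace X) e))
                 = {\<lambda>p\<in>mspace (completion_of (topspace X) e). p}))
         \<and> Met_tb_topology X closure_of (Rigid X \<inter> Met_tb X) = Met_tb X"
proof -
  obtain T where "T \<subseteq> topspace X" "card T = 3"
  proof (cases "finite (topspace X)")
    case True
    then show ?thesis
      using assms(2) that obtain_subset_with_card_n[of 3 "topspace X"] by auto
  next
    case False
    then show ?thesis
      using that infinite_arbitrarily_large[of "topspace X" 3] by blast
  qed
  then obtain u v w where uvw:
    "u \<in> topspace X" "v \<in> topspace X" "w \<in> topspace X" "u \<noteq> v" "u \<noteq> w" "v \<noteq> w"
    by (auto simp: card_3_iff)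
  have approx: "\<exists>e\<in>Met_tb X. sup_dist (topspace X) d e < ennreal \<epsilon> \<and>
      self_rigid (completion_of (topspace X) e)" if "d \<in> Met_tb X" "0 < \<epsilon>" for d and \<epsilon> :: real
    using Met_tb_rigid_perturbation[OF uvw that] by metis
  let ?U = "uniform_dist (topspace X)"
  interpret U: Metric_space "Met X" ?U
    by (rule Metric_space_Met)
  \<comment> \<open>The closure is taken in all of \<open>Met X\<close>; intersecting it with
    \<open>Met_tb X\<close> gives the closure in the subspace.\<close>
  have "d \<in> U.mtopology closure_of (Rigid X \<inter> Met_tb X)" if d: "d \<in> Met_tb X" for d
    unfolding U.metric_closure_of
  proof (intro CollectI conjI allI impI)
    show "d \<in> Met X"
      using d by (simp add: Met_tb_def)
    fix \<rho> :: real assume "0 < \<rho>"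
    then obtain e where e: "e \<in> Met_tb X" "sup_dist (topspace X) d e < ennreal \<rho>"
      "self_rigid (completion_of (topspace X) e)"
      using approx[OF d] by blast
    have "Metric_space (topspace X) e" "e \<in> Met X"
      using e(1) by (auto simp: Met_tb_def Met_def)
    then have "e \<in> Rigid X"
      using Metric_space.self_rigid_completion_imp_Isom_trivial e(3) by (auto simp: Rigid_def)
    moreover have "min 1 (sup_dist (topspace X) d e) < ennreal \<rho>"
      using e(2) by (simp add: min.strict_coboundedI2)
    then have "?U d e < \<rho>"
      unfolding uniform_dist_def using \<open>0 < \<rho>\<close>
      by (metis enn2real_nonneg ennreal_enn2real ennreal_less_iff ennreal_less_top less_trans)
    ultimately show "\<exists>e\<in>Rigid X \<inter> Met_tb X. e \<in> U.mball d \<rho>"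
      using e(1) \<open>d \<in> Met X\<close> \<open>e \<in> Met X\<close> by (auto simp: U.in_mball)
  qed
  then have "Met_tb_topology X closure_of (Rigid X \<inter> Met_tb X) = Met_tb X"
    by (auto simp: Met_tb_topology_def Met_topology_def closure_of_subtopology Int_absorb1)
  moreover have "\<exists>e\<in>Met_tb X. sup_dist (topspace X) d e < ennreal \<epsilon> \<and>
      Isom (mspace (completion_of (topspace X) e)) (mdist (completion_of (topspace X) e))
        = {\<lambda>p\<in>mspace (completion_of (topspace X) e). p}" if "d \<in> Met_tb X" "0 < \<epsilon>" for d and \<epsilon> :: real
    using approx[OF that] self_rigid_imp_Isom_trivial by blast
  ultimately show ?thesis
    by blast
qed

end
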